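(* Let $k\in\mathbb{N}$, and let $k$ runners run clockwise along the circle $C=\mathbb{R}/\mathbb{Z}$ of length $1$ with constant rationally independent (thus distinct) speeds $\xi_1,\xi_2,\ldots,\xi_k>0$, starting from arbitrary points $\beta_1,\ldots,\beta_k\in C$. Then for every circular arc $A\subset C$ (of positive length) and for every $T>0$, there exists $t>T$ such that all $k$ runners are in $A$ at time $t$, i.e. $\xi_i t+\beta_i \bmod 1\in A$ for all $i=1,\ldots,k$.
   Context: $C=[0,1)\bmod 1=\mathbb{R}/\mathbb{Z}$ is the circle of length $1$. A circular arc of $C$ is the image in $\mathbb{R}/\mathbb{Z}$ of an interval of $\mathbb{R}$ of positive length at most $1$. A runner with constant speed $\xi>0$ and starting point $\beta\in C$ is at position $\xi t+\beta \bmod 1$ at time $t\ge 0$ (clockwise is the direction of increasing parameter). Real numbers $\xi_1,\ldots,\xi_k$ are rationally independent if no relation $c_1\xi_1+c_2\xi_2+\cdots+c_k\xi_k=0$ holds with integer coefficients $c_1,\ldots,c_k$ that are not all zero. *)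

theory Defs
  imports Complex_Main
begin

text \<open>The circle \<open>\<real>/\<int>\<close> is represented by the representatives in \<open>[0,1)\<close>;
  the quotient map \<open>\<real> \<rightarrow> \<real>/\<int>\<close> is then \<open>frac\<close>.\<close>

definition circle :: "real set" where
  "circle = {0..<1}"

definition circular_arc :: "real set \<Rightarrow> bool" where
  "circular_arc A \<longleftrightarrow>
     (\<exists>a b. a < b \<and> b - a \<le> 1 \<and>
        A \<in> (`) frac ` {{a<..<b}, {a..<b}, {a<..b}, {a..b}})"

definition runner_pos :: "real \<Rightarrow> real \<Rightarrow> real \<Rightarrow> real" where
  "runner_pos \<xi> \<beta> t = frac (\<xi> * t + \<beta>)"

definition rationally_independent :: "nat \<Rightarrow> (nat \<Rightarrow> real) \<Rightarrow> bool" where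
  "rationally_independent k \<xi> \<longleftrightarrow>
     (\<forall>c :: nat \<Rightarrow> int. (\<Sum>i=1..k. of_int (c i) * \<xi> i) = 0 \<longrightarrow> (\<forall>i\<in>{1..k}. c i = 0))"

end

theory Submission
  imports Defs "HOL-Analysis.Kronecker_Approximation_Theorem"
begin

text \<open>Kronecker's theorem provides a time, possibly negative, at which every runner is close to
  the midpoint of the arc. Dirichlet's simultaneous approximation theorem, applied to the
  displacements over a long time \<open>R\<close>, provides a multiple \<open>s \<ge> R\<close> of \<open>R\<close> after which every runner
  has almost returned to its position; adding \<open>s\<close> makes the time exceed \<open>T\<close>.\<close>

lemma simultaneous_return_time:
  fixes \<theta> :: "nat \<Rightarrow> real"
  assumes "\<epsilon> > 0"
  obtains s p where "s \<ge> R" "\<And>i. i < n \<Longrightarrow> \<bar>s * \<theta> i - of_int (p i)\<bar> < \<epsilon>"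
proof -
  \<comment> \<open>The bound \<open>R\<close> may be negative; with \<open>R'\<close> positive,
    \<open>q \<ge> 1\<close> gives \<open>q * R' \<ge> R' \<ge> R\<close>.\<close>
  define R' where "R' = max R 1"
  obtain N :: nat where N: "N > 0" "1 / real N < \<epsilon>"
    using assms by (metis inverse_eq_divide reals_Archimedean zero_less_Suc)
  obtain q p where q: "0 < q"
    and p: "\<And>i. i < n \<Longrightarrow> \<bar>of_int q * (R' * \<theta> i) - of_int (p i)\<bar> < 1 / real N"
    using Dirichlet_approx_simult [OF \<open>N > 0\<close>, of n "\<lambda>i. R' * \<theta> i"] by metis
  show thesis
  proof
    have "1 * R' \<le> of_int q * R'"
      using q by (intro mult_right_mono) (auto simp: R'_def)
    then show "of_int q * R' \<ge> R"
      by (simp add: R'_def)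
  next
    fix i assume "i < n"
    then show "\<bar>of_int q * R' * \<theta> i - of_int (p i)\<bar> < \<epsilon>"
      using p[of i] N(2) by (simp add: mult.assoc)
  qed
qed

lemma Kronecker_thm_1_late:
  fixes \<alpha> \<theta> :: "nat \<Rightarrow> real"
  assumes "module.independent (\<lambda>r. (*) (real_of_int r)) (\<theta> ` {..<n})"
    and "inj_on \<theta> {..<n}" and "\<epsilon> > 0"
  obtains t h where "t > T" "\<And>i. i < n \<Longrightarrow> \<bar>t * \<theta> i - of_int (h i) - \<alpha> i\<bar> < \<epsilon>"
proof -
  obtain u g where u: "\<And>i. i < n \<Longrightarrow> \<bar>u * \<theta> i - of_int (g i) - \<alpha> i\<bar> < \<epsilon> / 2"
    using Kronecker_thm_1 [OF assms(1,2), of "\<epsilon> / 2" \<alpha>] \<open>\<epsilon> > 0\<close> by auto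
  \<comment> \<open>The bound \<open>T - u + 1\<close> pushes \<open>u + s\<close> past
    \<open>T\<close> whatever the sign of \<open>u\<close>. The two errors, each below
    \<open>\<epsilon> / 2\<close>, add up to less than \<open>\<epsilon>\<close>.\<close>
  obtain s p where s: "s \<ge> T - u + 1" "\<And>i. i < n \<Longrightarrow> \<bar>s * \<theta> i - of_int (p i)\<bar> < \<epsilon> / 2"
    using simultaneous_return_time [of "\<epsilon> / 2" "T - u + 1" n \<theta>] \<open>\<epsilon> > 0\<close> by auto
  show thesis
  proof
    show "u + s > T"
      using s(1) by simp
  next
    fix i assume "i < n"
    then show "\<bar>(u + s) * \<theta> i - of_int (g i + p i) - \<alpha> i\<bar> < \<epsilon>"
      using u[of i] s(2)[of i] unfolding of_int_add distrib_right by linarith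
  qed
qed

text \<open>Two equal speeds would satisfy a nontrivial relation with coefficients 1 and -1.
  Kronecker's theorem needs this separately, since independence of the set of speeds does not see
  repetitions.\<close>

lemma rationally_independent_inj_on:
  assumes "rationally_independent k \<xi>"
  shows "inj_on \<xi> {1..k}"
proof (rule inj_onI, rule ccontr)
  fix i j assume ij: "i \<in> {1..k}" "j \<in> {1..k}" "\<xi> i = \<xi> j" "i \<noteq> j"
  define c :: "nat \<Rightarrow> int" where "c = (\<lambda>l. (if l = i then 1 else 0) - (if l = j then 1 else 0))"
  have "of_int (c l) * \<xi> l = (if l = i then \<xi> l else 0) - (if l = j then \<xi> l else 0)" for l
    by (simp add: c_def)
  then have "(\<Sum>l=1..k. of_int (c l) * \<xi> l) = 0"
    using ij by (simp add: sum_subtractf)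
  then have "c i = 0"
    using assms ij(1) unfolding rationally_independent_def by blast
  with ij(4) show False
    by (simp add: c_def)
qed

text \<open>Passes from indexed families to subsets of the \<int>-module of reals: by injectivity, a
  relation over the image with coefficients \<open>f\<close> is one over the indices with
  coefficients \<open>f (\<xi> i)\<close>.\<close>

lemma rationally_independent_imp_independent:
  assumes "rationally_independent k \<xi>"
  shows "module.independent (\<lambda>r. (*) (real_of_int r)) (\<xi> ` {1..k})"
proof -
  interpret Modules.module "(\<lambda>r. (*) (real_of_int r))"
    by (simp add: Modules.module.intro distrib_left mult.commute)
  have "f (\<xi> i) = 0" if "(\<Sum>x\<in>\<xi> ` {1..k}. real_of_int (f x) * x) = 0" "i \<in> {1..k}" for f i
  proof -
    have "(\<Sum>i=1..k. of_int (f (\<xi> i)) * \<xi> i) = 0"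
      using that(1) by (simp only: sum.reindex [OF rationally_independent_inj_on[OF assms]] o_def)
    then show ?thesis
      using assms that(2) unfolding rationally_independent_def
      by (elim allE [of _ "\<lambda>i. f (\<xi> i)"]) blast
  qed
  then show ?thesis
    by (subst dependent_finite) auto
qed

text \<open>Take the midpoint and half the length of the interval. Only its interior is used, which
  treats all four kinds of interval alike; the integer \<open>h\<close> absorbs the wrap-around of
  the circle.\<close>

lemma circular_arc_contains_ball:
  assumes "circular_arc A"
  obtains m \<epsilon> where "\<epsilon> > 0" "\<And>x h. \<bar>x - of_int h - m\<bar> < \<epsilon> \<Longrightarrow> frac x \<in> A"
proof -
  obtain a b where ab: "a < b" and A: "A \<in> (`) frac ` {{a<..<b}, {a..<b}, {a<..b}, {a..b}}"
    using assms unfolding circular_arc_def by blast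
  then have sub: "frac ` {a<..<b} \<subseteq> A"
    by auto
  show thesis
  proof
    show "(b - a) / 2 > 0"
      using ab by simp
  next
    fix x h assume "\<bar>x - of_int h - (a + b) / 2\<bar> < (b - a) / 2"
    then have "x - of_int h \<in> {a<..<b}"
      by (auto simp: abs_less_iff field_simps)
    with sub have "frac (x - of_int h) \<in> A"
      by blast
    moreover have "frac (x - of_int h) = frac x"
      by (simp add: frac_def)
    ultimately show "frac x \<in> A"
      by simp
  qed
qed

theorem theorem4:
  fixes k :: nat and \<xi> \<beta> :: "nat \<Rightarrow> real" and A :: "real set" and T :: real
  assumes "\<And>i. i \<in> {1..k} \<Longrightarrow> \<xi> i > 0"
    and "rationally_independent k \<xi>"
    and "\<And>i. i \<in> {1..k} \<Longrightarrow> \<beta> i \<in> circle"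
    and "circular_arc A"
    and "T > 0"
  shows "\<exists>t>T. \<forall>i\<in>{1..k}. runner_pos (\<xi> i) (\<beta> i) t \<in> A"
proof -
  obtain m \<epsilon> where "\<epsilon> > 0" and ball: "\<And>x h. \<bar>x - of_int h - m\<bar> < \<epsilon> \<Longrightarrow> frac x \<in> A"
    using circular_arc_contains_ball[OF assms(4)] by blast
  \<comment> \<open>Runners are numbered from 1, but Kronecker's theorem indexes from 0.\<close>
  have img: "Suc ` {..<k} = {1..k}"
    by (simp add: image_Suc_lessThan)
  have indep: "module.independent (\<lambda>r. (*) (real_of_int r)) ((\<xi> \<circ> Suc) ` {..<k})"
    using rationally_independent_imp_independent[OF assms(2)] by (metis image_comp img)
  have inj: "inj_on (\<xi> \<circ> Suc) {..<k}"
    using rationally_independent_inj_on[OF assms(2)] by (intro comp_inj_on) (simp_all only: img inj_Suc)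
  \<comment> \<open>Subtracting the starting point from the target \<open>m\<close> turns an
    approximation of \<open>t * \<xi> i\<close> into one of the runner's position.\<close>
  obtain t h where "t > T"
    and t: "\<And>i. i < k \<Longrightarrow> \<bar>t * (\<xi> \<circ> Suc) i - of_int (h i) - (m - \<beta> (Suc i))\<bar> < \<epsilon>"
    using Kronecker_thm_1_late[OF indep inj \<open>\<epsilon> > 0\<close>, of T "\<lambda>i. m - \<beta> (Suc i)"] by blast
  have "runner_pos (\<xi> i) (\<beta> i) t \<in> A" if "i \<in> {1..k}" for i
  proof -
    obtain j where j: "j < k" "i = Suc j"
      using \<open>i \<in> {1..k}\<close> img by blast
    have "\<bar>(\<xi> i * t + \<beta> i) - of_int (h j) - m\<bar> < \<epsilon>"
      using t[OF j(1)] by (simp add: j(2) algebra_simps)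
    then show ?thesis
      unfolding runner_pos_def by (rule ball)
  qed
  with \<open>t > T\<close> show ?thesis
    by blast
qed

end
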